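(* Consider a Fisher market instance with finite agent set $\mathcal{A}$, finite goods set $\mathcal{M}$, (concave) utility functions $u_i:\mathbb{R}_{\ge 0}^{\mathcal{M}}\to\mathbb{R}_{\ge0}$ and budgets $b_i>0$, $i\in\mathcal{A}$. Let $(\mathbf{y}_i)_{i\in\mathcal{A}}$ be any Nash welfare maximizing allocation and let $\mathbf{q}$ be dual prices (Gale prices), i.e. an optimal solution of the Lagrangian dual of the Eisenberg--Gale program. Then $((\mathbf{y}_i)_{i\in\mathcal{A}},\mathbf{q})$ is a $2$-demand-approximate competitive equilibrium. This also implies that if all $b_i$ are identical, then $(\mathbf{y}_i)_{i\in\mathcal{A}}$ is half envy-free: $u_i(\mathbf{y}_i)\ge\frac12 u_i(\mathbf{y}_k)$ for all $i,k\in\mathcal{A}$.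
   Context: Utility function: a function $u:\mathbb{R}_{\ge 0}^{\mathcal{M}}\to\mathbb{R}_{\ge 0}$ with $u(\mathbf{0})=0$ that is concave, continuous, monotone non-decreasing, and satisfies $u(\mathbf{x})>0$ for some $\mathbf{x}$. Fisher market instance: a finite set $\mathcal{A}$ of agents, a finite set $\mathcal{M}$ of divisible goods with one unit of each good available, and for each agent $i$ a utility function $u_i$ and a budget $b_i>0$. An allocation is $(\mathbf{y}_i)_{i\in\mathcal{A}}$ with $\mathbf{y}_i\in\mathbb{R}_{\ge 0}^{\mathcal{M}}$. Nash welfare of $(\mathbf{y}_i)$: $\left(\prod_{i} u_i(\mathbf{y}_i)^{b_i}\right)^{1/\sum_i b_i}$. A Nash welfare maximizing allocation attains the highest Nash welfare among all allocations with $\sum_i y_{ij}\le 1$ for all $j\in\mathcal{M}$; equivalently it is an optimal solution of the Eisenberg--Gale program $\max\{\sum_i b_i\log u_i(\mathbf{y}_i):\ \sum_i y_{ij}\le 1\ \forall j\in\mathcal{M},\ \mathbf{y}_i\ge \mathbf{0}\ \forall i\in\mathcal{A}\}$ (with $\log 0=-\infty$). Dual (Gale) prices: a minimizer $\mathbf{q}\in\mathbb{R}_{\ge0}^{\mathcal{M}}$ of the Lagrangian dual function $\varphi(\mathbf{q})=\sum_{i\in\mathcal{A}}\sup_{\mathbf{z}\in\mathbb{R}_{\ge0}^{\mathcal{M}}}\left(b_i\log u_i(\mathbf{z})-\langle\mathbf{q},\mathbf{z}\rangle\right)+\sum_{j\in\mathcal{M}}q_j$ over those $\mathbf{q}\in\mathbb{R}_{\ge0}^{\mathcal{M}}$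 with $\varphi(\mathbf{q})<\infty$. $\alpha$-demand-approximate competitive equilibrium ($\alpha\ge1$): an allocation and prices $((\mathbf{x}_i)_{i\in\mathcal{A}},\mathbf{p})$, $\mathbf{p}\in\mathbb{R}_{\ge0}^{\mathcal{M}}$, such that (i) for every $i$, $\langle\mathbf{p},\mathbf{x}_i\rangle\le b_i$ and $u_i(\mathbf{x}_i)\ge\frac1\alpha u_i(\mathbf{z})$ for every $\mathbf{z}\in\mathbb{R}_{\ge0}^{\mathcal{M}}$ with $\langle\mathbf{p},\mathbf{z}\rangle\le b_i$; (ii) $\sum_i x_{ij}\le1$ for all $j\in\mathcal{M}$; (iii) $\sum_i x_{ij}=1$ whenever $p_j>0$. *)

theory Defs
  imports "HOL-Analysis.Analysis"
begin

definition nonneg_orthant :: "(real ^ 'm::finite) set" where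
  "nonneg_orthant = {x. \<forall>j. 0 \<le> x $ j}"

text \<open>Bundles of goods are vectors indexed by the finite type \<open>'m\<close> of goods. Utilities are HOL
  functions on all of \<open>real ^ 'm\<close>, but only their values on the nonnegative orthant are ever
  used; monotonicity is with respect to the componentwise order.\<close>

definition utility_function :: "(real ^ 'm::finite \<Rightarrow> real) \<Rightarrow> bool" where
  "utility_function u \<longleftrightarrow>
     (\<forall>x\<in>nonneg_orthant. 0 \<le> u x) \<and>
     u 0 = 0 \<and>
     concave_on nonneg_orthant u \<and>
     continuous_on nonneg_orthant u \<and>
     mono_on nonneg_orthant u \<and>
     (\<exists>x\<in>nonneg_orthant. 0 < u x)"

definition fisher_market ::
  "'a set \<Rightarrow> ('a \<Rightarrow> real ^ 'm::finite \<Rightarrow> real) \<Rightarrow> ('a \<Rightarrow> real) \<Rightarrow> bool" where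
  "fisher_market A u b \<longleftrightarrow>
     finite A \<and> (\<forall>i\<in>A. utility_function (u i)) \<and> (\<forall>i\<in>A. 0 < b i)"

definition allocation :: "'a set \<Rightarrow> ('a \<Rightarrow> real ^ 'm::finite) \<Rightarrow> bool" where
  "allocation A y \<longleftrightarrow> (\<forall>i\<in>A. y i \<in> nonneg_orthant)"

definition within_supply :: "'a set \<Rightarrow> ('a \<Rightarrow> real ^ 'm::finite) \<Rightarrow> bool" where
  "within_supply A y \<longleftrightarrow> (\<forall>j. (\<Sum>i\<in>A. y i $ j) \<le> 1)"

definition nash_welfare ::
  "'a set \<Rightarrow> ('a \<Rightarrow> real ^ 'm::finite \<Rightarrow> real) \<Rightarrow> ('a \<Rightarrow> real) \<Rightarrow> ('a \<Rightarrow> real ^ 'm) \<Rightarrow> real" where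
  "nash_welfare A u b y = (\<Prod>i\<in>A. u i (y i) powr b i) powr (1 / (\<Sum>i\<in>A. b i))"

definition nash_welfare_maximizing ::
  "'a set \<Rightarrow> ('a \<Rightarrow> real ^ 'm::finite \<Rightarrow> real) \<Rightarrow> ('a \<Rightarrow> real) \<Rightarrow> ('a \<Rightarrow> real ^ 'm) \<Rightarrow> bool" where
  "nash_welfare_maximizing A u b y \<longleftrightarrow>
     allocation A y \<and> within_supply A y \<and>
     (\<forall>z. allocation A z \<and> within_supply A z \<longrightarrow> nash_welfare A u b z \<le> nash_welfare A u b y)"

text \<open>The real-valued library logarithm has \<open>ln 0 = 0\<close>, whereas the Eisenberg--Gale program needs
  \<open>log 0 = -\<infinity>\<close>. The function is only applied to nonnegative arguments.\<close>

definition ext_ln :: "real \<Rightarrow> ereal" where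
  "ext_ln t = (if 0 < t then ereal (ln t) else -\<infinity>)"

text \<open>The Lagrangian dual function of
  \<open>max {\<Sum>i. b i * log (u i (y i)) | \<Sum>i. y i $ j \<le> 1 for all j, y i \<ge> 0 for all i}\<close>,
  with the supply constraints dualized. In a Fisher market every supremum is greater than \<open>-\<infinity>\<close>,
  because every utility is positive somewhere; so the sum over the agents is never of the
  form \<open>\<infinity> - \<infinity>\<close>.\<close>

definition eg_dual ::
  "'a set \<Rightarrow> ('a \<Rightarrow> real ^ 'm::finite \<Rightarrow> real) \<Rightarrow> ('a \<Rightarrow> real) \<Rightarrow> real ^ 'm \<Rightarrow> ereal" where
  "eg_dual A u b q =
     (\<Sum>i\<in>A. SUP z\<in>nonneg_orthant. ereal (b i) * ext_ln (u i z) - ereal (q \<bullet> z))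
       + ereal (\<Sum>j\<in>UNIV. q $ j)"

definition gale_prices ::
  "'a set \<Rightarrow> ('a \<Rightarrow> real ^ 'm::finite \<Rightarrow> real) \<Rightarrow> ('a \<Rightarrow> real) \<Rightarrow> real ^ 'm \<Rightarrow> bool" where
  "gale_prices A u b q \<longleftrightarrow>
     q \<in> nonneg_orthant \<and> eg_dual A u b q < \<infinity> \<and>
     (\<forall>p\<in>nonneg_orthant. eg_dual A u b p < \<infinity> \<longrightarrow> eg_dual A u b q \<le> eg_dual A u b p)"

definition demand_approx_CE ::
  "real \<Rightarrow> 'a set \<Rightarrow> ('a \<Rightarrow> real ^ 'm::finite \<Rightarrow> real) \<Rightarrow> ('a \<Rightarrow> real) \<Rightarrow>
     ('a \<Rightarrow> real ^ 'm) \<Rightarrow> real ^ 'm \<Rightarrow> bool" where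
  "demand_approx_CE \<alpha> A u b x p \<longleftrightarrow>
     1 \<le> \<alpha> \<and> allocation A x \<and> p \<in> nonneg_orthant \<and>
     (\<forall>i\<in>A. p \<bullet> x i \<le> b i \<and>
        (\<forall>z\<in>nonneg_orthant. p \<bullet> z \<le> b i \<longrightarrow> (1 / \<alpha>) * u i z \<le> u i (x i))) \<and>
     within_supply A x \<and>
     (\<forall>j. 0 < p $ j \<longrightarrow> (\<Sum>i\<in>A. x i $ j) = 1)"

definition half_envy_free ::
  "'a set \<Rightarrow> ('a \<Rightarrow> real ^ 'm::finite \<Rightarrow> real) \<Rightarrow> ('a \<Rightarrow> real ^ 'm) \<Rightarrow> bool" where
  "half_envy_free A u y \<longleftrightarrow> (\<forall>i\<in>A. \<forall>k\<in>A. (1 / 2) * u i (y k) \<le> u i (y i))"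

end

theory Submission
  imports Defs
begin

text \<open>Separating the convex set of attainable (excess demand, objective gain) pairs from the origin,
  with half of the optimal allocation as Slater point, gives prices at which the optimal allocation
  maximizes the Lagrangian. By weak duality every dual minimizer then has this property as well, so
  \<open>y i\<close> maximizes \<open>b i * ln (u i z) - q \<bullet> z\<close> and complementary slackness holds.
  Moving from \<open>y i\<close> towards \<open>0\<close> gives the budget constraint; moving from \<open>y i\<close> in
  direction \<open>z\<close> raises the utility at rate at least \<open>u i z - u i (y i)\<close>, because
  \<open>u i (y i + z) \<ge> u i z\<close>, and this gives the factor 2. Half envy-freeness needs no prices:
  transfer a fraction of \<open>y k\<close> from \<open>k\<close> to \<open>i\<close>.\<close>

section \<open>Positive allocations, the logarithmic objective and saddle prices\<close>

text \<open>Positivity of all utilities keeps the objective real and away from the value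
  \<open>ln 0 = 0\<close>. Supply is left out because it is the dualized constraint.\<close>

definition positive_allocation ::
  "'a set \<Rightarrow> ('a \<Rightarrow> real ^ 'm::finite \<Rightarrow> real) \<Rightarrow> ('a \<Rightarrow> real ^ 'm) \<Rightarrow> bool" where
  "positive_allocation A u z \<longleftrightarrow> allocation A z \<and> (\<forall>i\<in>A. 0 < u i (z i))"

definition eg_objective ::
  "'a set \<Rightarrow> ('a \<Rightarrow> real ^ 'm::finite \<Rightarrow> real) \<Rightarrow> ('a \<Rightarrow> real) \<Rightarrow> ('a \<Rightarrow> real ^ 'm) \<Rightarrow> real" where
  "eg_objective A u b z = (\<Sum>i\<in>A. b i * ln (u i (z i)))"

text \<open>The Lagrangian at prices \<open>q\<close> never exceeds the objective value at
  \<open>y\<close>. No price term is charged at \<open>y\<close>, so taking \<open>z = y\<close>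
  already yields half of complementary slackness.\<close>

definition saddle_prices ::
  "'a set \<Rightarrow> ('a \<Rightarrow> real ^ 'm::finite \<Rightarrow> real) \<Rightarrow> ('a \<Rightarrow> real) \<Rightarrow> ('a \<Rightarrow> real ^ 'm) \<Rightarrow>
     real ^ 'm \<Rightarrow> bool" where
  "saddle_prices A u b y q \<longleftrightarrow> q \<in> nonneg_orthant \<and>
     (\<forall>z. positive_allocation A u z \<longrightarrow>
        eg_objective A u b z - eg_objective A u b y \<le> q \<bullet> ((\<Sum>i\<in>A. z i) - 1))"

section \<open>First-order conditions at the left end of an interval\<close>

lemma right_derivative_nonpos:
  fixes f :: "real \<Rightarrow> real"
  assumes "(f has_real_derivative D) (at 0)" and "f 0 = 0"
    and "\<And>t. 0 < t \<Longrightarrow> t < 1 \<Longrightarrow> f t \<le> 0"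
  shows "D \<le> 0"
proof (rule ccontr)
  assume "\<not> D \<le> 0"
  then obtain d where "0 < d" and d: "\<And>h. 0 < h \<Longrightarrow> h < d \<Longrightarrow> f 0 < f (0 + h)"
    using DERIV_pos_inc_right[OF assms(1)] by force
  define h where "h = min d 1 / 2"
  have "0 < h" "h < d" "h < 1" using \<open>0 < d\<close> by (auto simp: h_def)
  then show False using d[of h] assms(2) assms(3)[of h] by simp
qed

text \<open>Both sides vanish at \<open>t = 0\<close>, so their derivatives there,
  \<open>b * a\<close> and \<open>c\<close>, are ordered in the same way. This turns optimality
  along a ray into a linear inequality.\<close>

lemma ln_linear_growth_bound:
  fixes b a c :: real
  assumes "\<And>t. 0 < t \<Longrightarrow> t < 1 \<Longrightarrow> b * ln (1 + t * a) \<le> t * c"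
  shows "b * a \<le> c"
proof -
  have "((\<lambda>t. b * ln (1 + t * a) - t * c) has_real_derivative b * a - c) (at 0)"
    by (auto intro!: derivative_eq_intros)
  then have "b * a - c \<le> 0"
    by (rule right_derivative_nonpos) (use assms in auto)
  then show ?thesis by simp
qed

section \<open>Concave monotone utilities along segments\<close>

lemma nonneg_orthant_0: "0 \<in> nonneg_orthant"
  and nonneg_orthant_add: "x \<in> nonneg_orthant \<Longrightarrow> z \<in> nonneg_orthant \<Longrightarrow> x + z \<in> nonneg_orthant"
  and nonneg_orthant_scaleR: "x \<in> nonneg_orthant \<Longrightarrow> 0 \<le> t \<Longrightarrow> t *\<^sub>R x \<in> nonneg_orthant"
  by (auto simp: nonneg_orthant_def)

lemmas nonneg_orthant_intros = nonneg_orthant_0 nonneg_orthant_add nonneg_orthant_scaleR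

lemma inner_one_vec: "(q :: real ^ 'm::finite) \<bullet> 1 = (\<Sum>j\<in>UNIV. q $ j)"
  by (simp add: inner_vec_def)

lemma utility_concaveD:
  assumes "utility_function u" "x \<in> nonneg_orthant" "z \<in> nonneg_orthant"
    and "0 \<le> s" "0 \<le> t" "s + t = 1"
  shows "s * u x + t * u z \<le> u (s *\<^sub>R x + t *\<^sub>R z)"
  using assms unfolding utility_function_def concave_on_iff by blast

lemma utility_scale:
  assumes u: "utility_function u" and x: "x \<in> nonneg_orthant" and "0 \<le> t" "t \<le> 1"
  shows "t * u x \<le> u (t *\<^sub>R x)"
  using utility_concaveD[OF u x nonneg_orthant_0, of t "1 - t"] assms
  by (simp add: utility_function_def)

text \<open>The point \<open>x + t *\<^sub>R z\<close> lies on the segment from \<open>x\<close> to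
  \<open>x + z\<close>, and monotonicity gives \<open>u z \<le> u (x + z)\<close>. The guaranteed
  rate \<open>u z - u x\<close>, rather than \<open>u z\<close>, is where the factor 2
  originates.\<close>

lemma utility_add_scaled:
  assumes u: "utility_function u" and x: "x \<in> nonneg_orthant" and z: "z \<in> nonneg_orthant"
    and t: "0 \<le> t" "t \<le> 1"
  shows "(1 - t) * u x + t * u z \<le> u (x + t *\<^sub>R z)"
proof -
  have xz: "x + z \<in> nonneg_orthant" using x z by (rule nonneg_orthant_add)
  have "z \<le> x + z" using x by (auto simp: less_eq_vec_def nonneg_orthant_def)
  then have "u z \<le> u (x + z)"
    using u z xz unfolding utility_function_def mono_on_def by blast
  then have "(1 - t) * u x + t * u z \<le> (1 - t) * u x + t * u (x + z)"
    using t by (simp add: mult_left_mono)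
  also have "\<dots> \<le> u ((1 - t) *\<^sub>R x + t *\<^sub>R (x + z))"
    using utility_concaveD[OF u x xz, of "1 - t" t] t by simp
  also have "(1 - t) *\<^sub>R x + t *\<^sub>R (x + z) = x + t *\<^sub>R z"
    by (simp add: algebra_simps)
  finally show ?thesis .
qed

text \<open>Dividing the preceding bound by \<open>u x\<close> and taking logarithms gives the form
  required by \<open>ln_linear_growth_bound\<close>.\<close>

lemma utility_add_scaled_pos:
  assumes "utility_function u" "x \<in> nonneg_orthant" "z \<in> nonneg_orthant" "0 < u x" "0 \<le> t" "t < 1"
  shows "0 < u (x + t *\<^sub>R z)" and "0 < 1 + t * (u z / u x - 1)"
    and "ln (1 + t * (u z / u x - 1)) \<le> ln (u (x + t *\<^sub>R z)) - ln (u x)"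
proof -
  have nn: "0 \<le> u z" using assms unfolding utility_function_def by blast
  have pos: "0 < (1 - t) * u x + t * u z"
    using assms nn by (intro add_pos_nonneg mult_pos_pos mult_nonneg_nonneg) auto
  have le: "(1 - t) * u x + t * u z \<le> u (x + t *\<^sub>R z)"
    using assms by (intro utility_add_scaled) auto
  have eq: "1 + t * (u z / u x - 1) = ((1 - t) * u x + t * u z) / u x"
    using assms(4) by (simp add: field_simps)
  show p: "0 < u (x + t *\<^sub>R z)" using pos le by linarith
  show p': "0 < 1 + t * (u z / u x - 1)" unfolding eq using pos assms(4) by simp
  have "ln (1 + t * (u z / u x - 1)) \<le> ln (u (x + t *\<^sub>R z) / u x)"
  proof (rule ln_mono)
    show "1 + t * (u z / u x - 1) \<le> u (x + t *\<^sub>R z) / u x"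
      unfolding eq using le assms(4) by (simp add: divide_right_mono)
  qed (use p p' assms(4) in auto)
  then show "ln (1 + t * (u z / u x - 1)) \<le> ln (u (x + t *\<^sub>R z)) - ln (u x)"
    using p assms(4) by (simp add: ln_div)
qed

lemma ln_utility_concaveD:
  assumes u: "utility_function u" and x: "x \<in> nonneg_orthant" "0 < u x"
    and z: "z \<in> nonneg_orthant" "0 < u z" and st: "0 \<le> s" "0 \<le> t" "s + t = 1"
  shows "0 < u (s *\<^sub>R x + t *\<^sub>R z)"
    and "s * ln (u x) + t * ln (u z) \<le> ln (u (s *\<^sub>R x + t *\<^sub>R z))"
proof -
  have le: "s * u x + t * u z \<le> u (s *\<^sub>R x + t *\<^sub>R z)"
    using assms by (intro utility_concaveD) auto
  have pos: "0 < s * u x + t * u z"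
  \<comment> \<open>One weight may vanish: for \<open>s = 0\<close> the other weight is 1, and
    otherwise the first summand is already positive.\<close>
  proof (cases "s = 0")
    case True then show ?thesis using st z by simp
  next
    case False then show ?thesis using st x z
      by (intro add_pos_nonneg mult_pos_pos mult_nonneg_nonneg) auto
  qed
  show "0 < u (s *\<^sub>R x + t *\<^sub>R z)" using pos le by linarith
  have "s * ln (u x) + t * ln (u z) \<le> ln (s * u x + t * u z)"
    using concave_onD[OF ln_concave, of t "u x" "u z"] st x z by (simp add: eq_diff_eq[symmetric])
  also have "\<dots> \<le> ln (u (s *\<^sub>R x + t *\<^sub>R z))"
    using pos le by (intro ln_mono) auto
  finally show "s * ln (u x) + t * ln (u z) \<le> ln (u (s *\<^sub>R x + t *\<^sub>R z))" .
qed

section \<open>Changing the bundle of a single agent\<close>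

lemma positive_allocation_update:
  assumes "positive_allocation A u y" "v \<in> nonneg_orthant" "0 < u i v"
  shows "positive_allocation A u (y(i := v))"
  using assms by (auto simp: positive_allocation_def allocation_def)

lemma eg_objective_update:
  assumes "finite A" "i \<in> A"
  shows "eg_objective A u b (y(i := v))
           = eg_objective A u b y + b i * (ln (u i v) - ln (u i (y i)))"
  unfolding eg_objective_def using assms
  by (simp add: sum.remove[of A i] algebra_simps cong: sum.cong_simp)

lemma sum_update:
  fixes y :: "'a \<Rightarrow> 'b::ab_group_add"
  assumes "finite A" "i \<in> A"
  shows "(\<Sum>k\<in>A. (y(i := v)) k) = (\<Sum>k\<in>A. y k) + (v - y i)"
  using assms by (simp add: sum.remove[of A i] algebra_simps cong: sum.cong_simp)

lemma within_supply_iff: "within_supply A y \<longleftrightarrow> (\<forall>j. (\<Sum>i\<in>A. y i) $ j \<le> 1)"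
  by (simp add: within_supply_def)

section \<open>Nash welfare and the Eisenberg-Gale objective\<close>

lemma nash_welfare_eq_exp:
  assumes "fisher_market A u b" "positive_allocation A u z"
  shows "nash_welfare A u b z = exp (eg_objective A u b z / (\<Sum>i\<in>A. b i))"
proof -
  have fin: "finite A" using assms by (simp add: fisher_market_def)
  have "(\<Prod>i\<in>A. u i (z i) powr b i) = (\<Prod>i\<in>A. exp (b i * ln (u i (z i))))"
    using assms by (intro prod.cong) (auto simp: positive_allocation_def powr_def)
  also have "\<dots> = exp (eg_objective A u b z)"
    using fin by (simp add: exp_sum eg_objective_def)
  finally show ?thesis by (simp add: nash_welfare_def powr_def)
qed

text \<open>Bundles of positive utility can be scaled down until they fit the supply; concavity and
  \<open>u 0 = 0\<close> keep the utilities positive.\<close>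

lemma ex_positive_allocation_within_supply:
  assumes "fisher_market A u b"
  shows "\<exists>z. positive_allocation A u z \<and> within_supply A z"
proof -
  have fin: "finite A" and util: "\<And>i. i \<in> A \<Longrightarrow> utility_function (u i)"
    using assms by (auto simp: fisher_market_def)
  have "\<forall>i\<in>A. \<exists>x. x \<in> nonneg_orthant \<and> 0 < u i x"
    using util by (auto simp: utility_function_def)
  then obtain x where x: "\<And>i. i \<in> A \<Longrightarrow> x i \<in> nonneg_orthant" "\<And>i. i \<in> A \<Longrightarrow> 0 < u i (x i)"
    by metis
  \<comment> \<open>\<open>K\<close> dominates the demand for every single good, and the summand 1
    makes \<open>1 / K\<close> a legitimate factor in [0, 1].\<close>
  define K where "K = 1 + (\<Sum>j\<in>UNIV. \<Sum>i\<in>A. x i $ j)"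
  have nn: "0 \<le> (\<Sum>i\<in>A. x i $ j)" for j
    using x(1) by (auto intro!: sum_nonneg simp: nonneg_orthant_def)
  have bound: "(\<Sum>i\<in>A. x i $ j) \<le> K" for j
    using member_le_sum[of j UNIV "\<lambda>j. \<Sum>i\<in>A. x i $ j"] nn by (simp add: K_def)
  have K: "1 \<le> K" using nn by (simp add: K_def sum_nonneg)
  define z where "z i = (1 / K) *\<^sub>R x i" for i
  have "positive_allocation A u z"
    unfolding positive_allocation_def allocation_def
  proof (intro conjI ballI)
    fix i assume i: "i \<in> A"
    show "z i \<in> nonneg_orthant" using x(1)[OF i] K by (auto simp: z_def nonneg_orthant_def)
    have "0 < (1 / K) * u i (x i)" using x(2)[OF i] K by simp
    also have "\<dots> \<le> u i (z i)"
      unfolding z_def using K by (intro utility_scale util x i) auto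
    finally show "0 < u i (z i)" .
  qed
  moreover have "within_supply A z"
    using bound K by (auto simp: within_supply_def z_def sum_divide_distrib[symmetric])
  ultimately show ?thesis by blast
qed

text \<open>Some feasible allocation has positive welfare, whereas one agent of utility 0 would make
  the product, and hence the welfare, zero.\<close>

lemma nash_welfare_maximizing_positive:
  assumes "fisher_market A u b" "nash_welfare_maximizing A u b y"
  shows "positive_allocation A u y"
proof -
  obtain z where z: "positive_allocation A u z" "within_supply A z"
    using ex_positive_allocation_within_supply[OF assms(1)] by blast
  have "0 < nash_welfare A u b z" using nash_welfare_eq_exp[OF assms(1) z(1)] by simp
  also have "\<dots> \<le> nash_welfare A u b y"
    using assms(2) z by (auto simp: nash_welfare_maximizing_def positive_allocation_def)
  finally have "(\<Prod>i\<in>A. u i (y i) powr b i) \<noteq> 0" by (auto simp: nash_welfare_def)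
  moreover have "finite A" using assms(1) by (simp add: fisher_market_def)
  ultimately have "\<forall>i\<in>A. u i (y i) \<noteq> 0" by (auto simp: prod_zero_iff)
  moreover have "\<forall>i\<in>A. 0 \<le> u i (y i)" and "allocation A y"
    using assms
    by (auto simp: fisher_market_def utility_function_def nash_welfare_maximizing_def allocation_def)
  ultimately show ?thesis by (auto simp: positive_allocation_def less_le)
qed

lemma nash_welfare_maximizing_eg_objective:
  assumes market: "fisher_market A u b" and max: "nash_welfare_maximizing A u b y"
    and z: "positive_allocation A u z" "within_supply A z"
  shows "eg_objective A u b z \<le> eg_objective A u b y"
\<comment> \<open>Without agents the budget sum is 0 and cannot be cancelled in the
  exponent.\<close>
proof (cases "A = {}")
  case True
  then show ?thesis by (simp add: eg_objective_def)
next
  case False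
  then have B: "0 < (\<Sum>i\<in>A. b i)"
    using market by (auto simp: fisher_market_def intro!: sum_pos)
  have "nash_welfare A u b z \<le> nash_welfare A u b y"
    using max z by (auto simp: nash_welfare_maximizing_def positive_allocation_def)
  then show ?thesis
    using B nash_welfare_eq_exp[OF market z(1)]
      nash_welfare_eq_exp[OF market nash_welfare_maximizing_positive[OF market max]]
    by (simp add: divide_le_cancel)
qed

section \<open>Existence of saddle prices by separation\<close>

lemma convex_combination_allocation:
  assumes market: "fisher_market A u b"
    and x: "positive_allocation A u x" and z: "positive_allocation A u z"
    and st: "0 \<le> s" "0 \<le> t" "s + t = 1"
  shows "positive_allocation A u (\<lambda>i. s *\<^sub>R x i + t *\<^sub>R z i)"
    and "s * eg_objective A u b x + t * eg_objective A u b z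
           \<le> eg_objective A u b (\<lambda>i. s *\<^sub>R x i + t *\<^sub>R z i)"
proof -
  have 1: "0 < u i (s *\<^sub>R x i + t *\<^sub>R z i)"
    and 2: "s * ln (u i (x i)) + t * ln (u i (z i)) \<le> ln (u i (s *\<^sub>R x i + t *\<^sub>R z i))"
    if "i \<in> A" for i
    using ln_utility_concaveD[of "u i" "x i" "z i" s t] that assms
    by (auto simp: fisher_market_def positive_allocation_def allocation_def)
  show "positive_allocation A u (\<lambda>i. s *\<^sub>R x i + t *\<^sub>R z i)"
    using 1 x z st
    by (auto simp: positive_allocation_def allocation_def intro!: nonneg_orthant_intros)
  have "s * eg_objective A u b x + t * eg_objective A u b z
          = (\<Sum>i\<in>A. b i * (s * ln (u i (x i)) + t * ln (u i (z i))))"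
    by (simp add: eg_objective_def sum_distrib_left sum.distrib algebra_simps)
  also have "\<dots> \<le> eg_objective A u b (\<lambda>i. s *\<^sub>R x i + t *\<^sub>R z i)"
    unfolding eg_objective_def using 2 market
    by (intro sum_mono mult_left_mono) (auto simp: fisher_market_def less_imp_le)
  finally show "s * eg_objective A u b x + t * eg_objective A u b z
    \<le> eg_objective A u b (\<lambda>i. s *\<^sub>R x i + t *\<^sub>R z i)" .
qed

text \<open>Concavity of the objective gives convexity. The set is upward closed in \<open>v\<close>
  and strict in \<open>r\<close>; strictness keeps the origin outside once \<open>V\<close> is the
  optimal value.\<close>

lemma convex_attainable:
  fixes u :: "'a \<Rightarrow> real ^ 'm::finite \<Rightarrow> real"
  assumes market: "fisher_market A u b"
  shows "convex {(v, r). \<exists>z. positive_allocation A u z \<and>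
           (\<Sum>i\<in>A. z i) - 1 \<le> v \<and> r < eg_objective A u b z - V}"
    (is "convex ?S")
  unfolding convex_def
proof (intro ballI allI impI)
  fix p p' :: "(real ^ 'm) \<times> real" and s t :: real
  assume p: "p \<in> ?S" "p' \<in> ?S" and st: "0 \<le> s" "0 \<le> t" "s + t = 1"
  obtain v r v' r' where [simp]: "p = (v, r)" "p' = (v', r')" by (cases p, cases p')
  obtain z z' where z: "positive_allocation A u z" "(\<Sum>i\<in>A. z i) - 1 \<le> v" "r < eg_objective A u b z - V"
    and z': "positive_allocation A u z'" "(\<Sum>i\<in>A. z' i) - 1 \<le> v'" "r' < eg_objective A u b z' - V"
    using p by auto
  define w where "w = (\<lambda>i. s *\<^sub>R z i + t *\<^sub>R z' i)"
  note w = convex_combination_allocation[OF market z(1) z'(1) st, folded w_def]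
  have "(\<Sum>i\<in>A. w i) - 1 \<le> s *\<^sub>R v + t *\<^sub>R v'"
    unfolding less_eq_vec_def
  proof
    fix j
    \<comment> \<open>The constant 1 is written as \<open>s + t\<close> so that it can be shared
      between the two excess demands.\<close>
    have "((\<Sum>i\<in>A. w i) - 1) $ j = s * (\<Sum>i\<in>A. z i $ j) + t * (\<Sum>i\<in>A. z' i $ j) - (s + t)"
      using st by (simp add: w_def sum.distrib sum_distrib_left)
    also have "\<dots> = s * ((\<Sum>i\<in>A. z i $ j) - 1) + t * ((\<Sum>i\<in>A. z' i $ j) - 1)"
      by (simp add: algebra_simps)
    also have "\<dots> \<le> s * v $ j + t * v' $ j"
      using z(2) z'(2) st by (intro add_mono mult_left_mono) (auto simp: less_eq_vec_def)
    finally show "((\<Sum>i\<in>A. w i) - 1) $ j \<le> (s *\<^sub>R v + t *\<^sub>R v') $ j" by simp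
  qed
  moreover have "s * r + t * r' < eg_objective A u b w - V"
  proof -
    have "s * r + t * r' < s * (eg_objective A u b z - V) + t * (eg_objective A u b z' - V)"
    \<comment> \<open>Strictness comes from whichever point has positive weight.\<close>
    proof (cases "s = 0")
      case True then show ?thesis using st z'(3) by simp
    next
      case False then show ?thesis using st z(3) z'(3)
        by (intro add_less_le_mono mult_strict_left_mono mult_left_mono) auto
    qed
    also have "\<dots> = s * eg_objective A u b z + t * eg_objective A u b z' - (s + t) * V"
      by (simp add: algebra_simps)
    also have "\<dots> \<le> eg_objective A u b w - V" using w(2) st by simp
    finally show ?thesis .
  qed
  ultimately show "s *\<^sub>R p + t *\<^sub>R p' \<in> ?S" using w(1) by auto
qed

lemma saddle_prices_exist:
  fixes u :: "'a \<Rightarrow> real ^ 'm::finite \<Rightarrow> real"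
  assumes market: "fisher_market A u b" and max: "nash_welfare_maximizing A u b y"
  shows "\<exists>p. saddle_prices A u b y p"
proof -
  define S where "S = {(v, r). \<exists>z. positive_allocation A u z \<and>
           (\<Sum>i\<in>A. z i) - 1 \<le> v \<and> r < eg_objective A u b z - eg_objective A u b y}"
  have SI: "(v, r) \<in> S" if "positive_allocation A u z" "(\<Sum>i\<in>A. z i) - 1 \<le> v"
    "r < eg_objective A u b z - eg_objective A u b y" for v r z
    using that by (auto simp: S_def)
  note pos = nash_welfare_maximizing_positive[OF market max]
  have feasible: "(\<Sum>i\<in>A. y i) - 1 \<le> 0"
    using max by (auto simp: nash_welfare_maximizing_def within_supply_iff less_eq_vec_def)
  have "convex S" unfolding S_def by (rule convex_attainable[OF market])
  \<comment> \<open>The origin would stand for a feasible allocation with a larger objective than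
    \<open>y\<close>.\<close>
  moreover have "0 \<notin> S"
  proof
    assume "0 \<in> S"
    then obtain z where z: "positive_allocation A u z" "(\<Sum>i\<in>A. z i) - 1 \<le> 0"
      "0 < eg_objective A u b z - eg_objective A u b y"
      by (auto simp: S_def zero_prod_def)
    then have "within_supply A z" by (simp add: within_supply_iff less_eq_vec_def)
    then show False using nash_welfare_maximizing_eg_objective[OF market max z(1)] z(3) by simp
  qed
  ultimately have "\<exists>l. l \<noteq> 0 \<and> (\<forall>w\<in>S. 0 \<le> l \<bullet> w)"
    by (rule separating_hyperplane_set_0)
  then obtain l where "l \<noteq> 0" and l: "\<And>w. w \<in> S \<Longrightarrow> 0 \<le> l \<bullet> w" by blast
  obtain a c where l_eq: "l = (a, c)" by (cases l)
  have sep: "0 \<le> a \<bullet> v + c * r" if "(v, r) \<in> S" for v r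
    using l[OF that] by (simp add: l_eq)
  have a: "0 \<le> a $ j" for j
  proof (rule ccontr)
    assume neg: "\<not> 0 \<le> a $ j"
    \<comment> \<open>The size of \<open>k\<close> makes
      \<open>k * a $ j = - (\<bar>c\<bar> + 1)\<close>, so a large excess of good \<open>j\<close>
      violates the separation at \<open>r = - 1\<close>.\<close>
    define k where "k = (\<bar>c\<bar> + 1) / (- a $ j)"
    have "0 \<le> k" using neg unfolding k_def by (intro divide_nonneg_pos) auto
    then have "0 \<le> k *\<^sub>R axis j (1::real)" by (auto simp: less_eq_vec_def axis_def)
    then have "(k *\<^sub>R axis j 1, - 1) \<in> S"
      using pos order_trans[OF feasible] by (intro SI[of y]) simp_all
    from sep[OF this] have "0 \<le> k * a $ j - c" by (simp add: inner_axis)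
    moreover have "k * a $ j = - (\<bar>c\<bar> + 1)" using neg by (simp add: k_def)
    ultimately show False by linarith
  qed
  have "c \<le> 0"
  proof (rule ccontr)
    assume "\<not> c \<le> 0"
    moreover have "(0, - 1) \<in> S" using pos feasible by (intro SI[of y]) simp_all
    ultimately show False using sep[of 0 "- 1"] by simp
  qed
  moreover have "c \<noteq> 0"
  proof
    assume "c = 0"
    then have "a \<noteq> 0" using \<open>l \<noteq> 0\<close> by (simp add: l_eq zero_prod_def)
    then obtain j where "a $ j \<noteq> 0" by (auto simp: vec_eq_iff)
    then have sum_pos: "0 < (\<Sum>j\<in>UNIV. a $ j)"
      using a by (intro sum_pos2[of _ j]) (auto simp: less_le)
    \<comment> \<open>Slater point: halving \<open>y\<close> leaves at least half a unit of every
      good, so a nonzero \<open>a \<ge> 0\<close> alone cannot separate.\<close>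
    define h where "h = (\<lambda>i. (1 / 2) *\<^sub>R y i)"
    have "positive_allocation A u h"
      unfolding positive_allocation_def allocation_def
    proof (intro conjI ballI)
      fix i assume i: "i \<in> A"
      have yi: "y i \<in> nonneg_orthant" "0 < u i (y i)" "utility_function (u i)"
        using pos market i
        by (auto simp: positive_allocation_def allocation_def fisher_market_def)
      show "h i \<in> nonneg_orthant" unfolding h_def using yi by (intro nonneg_orthant_intros) auto
      show "0 < u i (h i)" using utility_scale[OF yi(3,1), of "1 / 2"] yi(2) by (simp add: h_def)
    qed
    moreover have "(\<Sum>i\<in>A. h i) - 1 \<le> (- 1 / 2) *\<^sub>R 1"
      using feasible
      by (auto simp: less_eq_vec_def h_def sum_divide_distrib[symmetric] field_simps)
    ultimately have "((- 1 / 2) *\<^sub>R 1, eg_objective A u b h - eg_objective A u b y - 1) \<in> S"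
      by (intro SI) auto
    from sep[OF this] show False using \<open>c = 0\<close> sum_pos by (simp add: inner_one_vec)
  qed
  ultimately have c: "c < 0" by simp
  \<comment> \<open>Rescaling gives the objective gain the coefficient -1, so that \<open>a\<close>
    becomes a price vector.\<close>
  define p where "p = (1 / (- c)) *\<^sub>R a"
  have "saddle_prices A u b y p"
    unfolding saddle_prices_def
  proof (intro conjI allI impI)
    show "p \<in> nonneg_orthant"
      using a c by (auto simp: p_def nonneg_orthant_def divide_nonneg_neg)
    fix z assume z: "positive_allocation A u z"
    let ?e = "(\<Sum>i\<in>A. z i) - 1"
    show "eg_objective A u b z - eg_objective A u b y \<le> p \<bullet> ?e"
    \<comment> \<open>Membership in \<open>S\<close> is strict in \<open>r\<close>, so the bound is
      shown for all smaller \<open>r\<close> and passes to the limit.\<close>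
    proof (rule dense_le)
      fix r assume "r < eg_objective A u b z - eg_objective A u b y"
      then have "0 \<le> a \<bullet> ?e + c * r" using z by (intro sep SI) auto
      then have "r * (- c) \<le> a \<bullet> ?e" by (simp add: mult.commute)
      then have "r \<le> (a \<bullet> ?e) / (- c)" using c by (subst pos_le_divide_eq) auto
      then show "r \<le> p \<bullet> ?e" by (simp add: p_def)
    qed
  qed
  then show ?thesis ..
qed

section \<open>Complementary slackness and optimality for each agent\<close>

text \<open>The saddle inequality at \<open>z = y\<close> and feasibility of \<open>y\<close> bound
  the value of the excess demand from both sides by 0. It is then a vanishing sum of terms of one
  sign.\<close>

lemma saddle_prices_slackness:
  assumes "saddle_prices A u b y q" "positive_allocation A u y" "within_supply A y"
  shows "q \<bullet> ((\<Sum>i\<in>A. y i) - 1) = 0"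
    and "0 < q $ j \<Longrightarrow> (\<Sum>i\<in>A. y i $ j) = 1"
proof -
  let ?f = "\<lambda>j. q $ j * (1 - (\<Sum>i\<in>A. y i $ j))"
  have nn: "0 \<le> ?f j" for j
    using assms by (auto simp: saddle_prices_def nonneg_orthant_def within_supply_def)
  have eq: "q \<bullet> ((\<Sum>i\<in>A. y i) - 1) = - (\<Sum>j\<in>UNIV. ?f j)"
    by (simp add: inner_vec_def sum_negf[symmetric] algebra_simps)
  moreover have "0 \<le> q \<bullet> ((\<Sum>i\<in>A. y i) - 1)"
    using assms(1,2) unfolding saddle_prices_def by (metis diff_self)
  moreover have "0 \<le> (\<Sum>j\<in>UNIV. ?f j)" using nn by (intro sum_nonneg) auto
  ultimately show 0: "q \<bullet> ((\<Sum>i\<in>A. y i) - 1) = 0" by linarith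
  then have "?f j = 0" using nn eq sum_nonneg_eq_0_iff[of UNIV ?f] by simp
  then show "0 < q $ j \<Longrightarrow> (\<Sum>i\<in>A. y i $ j) = 1" by simp
qed

text \<open>The saddle inequality is applied to \<open>y\<close> with only the bundle of
  \<open>i\<close> replaced; slackness removes the remaining price term.\<close>

lemma saddle_prices_agent_optimal:
  assumes "fisher_market A u b"
    and "saddle_prices A u b y q" "positive_allocation A u y" "within_supply A y"
    and "i \<in> A" "v \<in> nonneg_orthant" "0 < u i v"
  shows "b i * (ln (u i v) - ln (u i (y i))) \<le> q \<bullet> (v - y i)"
proof -
  have fin: "finite A" using assms(1) by (simp add: fisher_market_def)
  have "eg_objective A u b (y(i := v)) - eg_objective A u b y
          \<le> q \<bullet> ((\<Sum>k\<in>A. (y(i := v)) k) - 1)"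
    using assms(2) positive_allocation_update[where u = u, OF assms(3,6,7)]
    unfolding saddle_prices_def by blast
  moreover have "(\<Sum>k\<in>A. (y(i := v)) k) - 1 = ((\<Sum>k\<in>A. y k) - 1) + (v - y i)"
    unfolding sum_update[OF fin assms(5)] by simp
  ultimately show ?thesis
    using saddle_prices_slackness(1)[OF assms(2-4)]
    unfolding eg_objective_update[OF fin assms(5)] by (simp add: inner_simps)
qed

section \<open>Strong and weak duality\<close>

text \<open>Each agent's supremum is bounded by its value at \<open>y i\<close>, and by slackness
  the price terms cancel in the sum.\<close>

lemma saddle_prices_eg_dual_le:
  assumes market: "fisher_market A u b" and p: "saddle_prices A u b y p"
    and y: "positive_allocation A u y" "within_supply A y"
  shows "eg_dual A u b p \<le> ereal (eg_objective A u b y)"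
proof -
  have "(SUP z\<in>nonneg_orthant. ereal (b i) * ext_ln (u i z) - ereal (p \<bullet> z))
          \<le> ereal (b i * ln (u i (y i)) - p \<bullet> y i)" if i: "i \<in> A" for i
  proof (rule SUP_least)
    fix z :: "real ^ 'b" assume z: "z \<in> nonneg_orthant"
    \<comment> \<open>With a positive budget, a bundle of zero utility contributes minus infinity,
      so only bundles of positive utility need a bound.\<close>
    have "0 < b i" using market i by (simp add: fisher_market_def)
    moreover have "b i * ln (u i z) - p \<bullet> z \<le> b i * ln (u i (y i)) - p \<bullet> y i" if "0 < u i z"
      using saddle_prices_agent_optimal[OF market p y i z that]
      by (simp add: algebra_simps inner_diff_right)
    ultimately show "ereal (b i) * ext_ln (u i z) - ereal (p \<bullet> z)
        \<le> ereal (b i * ln (u i (y i)) - p \<bullet> y i)"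
      by (simp add: ext_ln_def)
  qed
  then have "eg_dual A u b p
      \<le> (\<Sum>i\<in>A. ereal (b i * ln (u i (y i)) - p \<bullet> y i)) + ereal (\<Sum>j\<in>UNIV. p $ j)"
    unfolding eg_dual_def by (intro add_right_mono sum_mono)
  also have "\<dots> = ereal (eg_objective A u b y - p \<bullet> ((\<Sum>i\<in>A. y i) - 1))"
    by (simp add: eg_objective_def sum_subtractf inner_diff_right inner_sum_right inner_one_vec)
  finally show ?thesis using saddle_prices_slackness(1)[OF p y] by simp
qed

text \<open>Weak duality: each supremum is at least the term at \<open>z i\<close>.\<close>

lemma eg_dual_ge:
  assumes "positive_allocation A u z"
  shows "ereal (eg_objective A u b z - q \<bullet> ((\<Sum>i\<in>A. z i) - 1)) \<le> eg_dual A u b q"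
proof -
  have "ereal (b i * ln (u i (z i)) - q \<bullet> z i)
          \<le> (SUP z\<in>nonneg_orthant. ereal (b i) * ext_ln (u i z) - ereal (q \<bullet> z))" if "i \<in> A" for i
    using assms that
    by (intro SUP_upper2[of "z i"]) (auto simp: positive_allocation_def allocation_def ext_ln_def)
  then have "(\<Sum>i\<in>A. ereal (b i * ln (u i (z i)) - q \<bullet> z i)) + ereal (\<Sum>j\<in>UNIV. q $ j)
      \<le> eg_dual A u b q"
    unfolding eg_dual_def by (intro add_right_mono sum_mono)
  moreover have "(\<Sum>i\<in>A. ereal (b i * ln (u i (z i)) - q \<bullet> z i)) + ereal (\<Sum>j\<in>UNIV. q $ j)
      = ereal (eg_objective A u b z - q \<bullet> ((\<Sum>i\<in>A. z i) - 1))"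
    by (simp add: eg_objective_def sum_subtractf inner_diff_right inner_sum_right inner_one_vec)
  ultimately show ?thesis by simp
qed

text \<open>A dual minimizer does at least as well as the prices found by separation, so its dual
  value is at most the objective at \<open>y\<close>. Weak duality at each positive \<open>z\<close>
  then is the saddle inequality.\<close>

lemma gale_prices_saddle:
  assumes market: "fisher_market A u b" and max: "nash_welfare_maximizing A u b y"
    and q: "gale_prices A u b q"
  shows "saddle_prices A u b y q"
proof -
  note pos = nash_welfare_maximizing_positive[OF market max]
  have feasible: "within_supply A y" using max by (simp add: nash_welfare_maximizing_def)
  obtain p where p: "saddle_prices A u b y p" using saddle_prices_exist[OF market max] by blast
  note p_le = saddle_prices_eg_dual_le[OF market p pos feasible]
  then have "eg_dual A u b p < \<infinity>" by (rule le_less_trans) simp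
  then have "eg_dual A u b q \<le> eg_dual A u b p"
    using q p by (simp add: gale_prices_def saddle_prices_def)
  with p_le have q_le: "eg_dual A u b q \<le> ereal (eg_objective A u b y)" by (rule order_trans[rotated])
  have "eg_objective A u b z - eg_objective A u b y \<le> q \<bullet> ((\<Sum>i\<in>A. z i) - 1)"
    if "positive_allocation A u z" for z
    using order_trans[OF eg_dual_ge[OF that] q_le] by simp
  then show ?thesis using q by (simp add: saddle_prices_def gale_prices_def)
qed

section \<open>The approximate equilibrium\<close>

lemma saddle_prices_demand_approx_CE:
  assumes market: "fisher_market A u b" and q: "saddle_prices A u b y q"
    and y: "positive_allocation A u y" "within_supply A y"
  shows "demand_approx_CE 2 A u b y q"
proof -
  have agent: "q \<bullet> y i \<le> b i"
    "z \<in> nonneg_orthant \<Longrightarrow> q \<bullet> z \<le> b i \<Longrightarrow> (1 / 2) * u i z \<le> u i (y i)"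
    if i: "i \<in> A" for i z
  proof -
    have yi: "y i \<in> nonneg_orthant" "0 < u i (y i)" and util: "utility_function (u i)"
      and b: "0 < b i"
      using y(1) market i by (auto simp: positive_allocation_def allocation_def fisher_market_def)
    note opt = saddle_prices_agent_optimal[OF market q y i]
    \<comment> \<open>Shrinking \<open>y i\<close> by the factor \<open>1 - t\<close> costs at most
      \<open>- b i * ln (1 - t)\<close> and saves \<open>t * (q \<bullet> y i)\<close>; the rates at
      \<open>t = 0\<close> give the budget bound.\<close>
    have "b i * (- 1) \<le> - (q \<bullet> y i)"
    proof (rule ln_linear_growth_bound)
      fix t :: real assume t: "0 < t" "t < 1"
      let ?v = "(1 - t) *\<^sub>R y i"
      have v: "?v \<in> nonneg_orthant" using yi t by (intro nonneg_orthant_intros) auto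
      have le: "(1 - t) * u i (y i) \<le> u i ?v" using t by (intro utility_scale util yi) auto
      have pos: "0 < (1 - t) * u i (y i)" using yi t by simp
      have "ln (1 - t) + ln (u i (y i)) \<le> ln (u i ?v)"
        using ln_mono[OF le] pos le yi t by (simp add: ln_mult)
      then have "b i * ln (1 - t) \<le> b i * (ln (u i ?v) - ln (u i (y i)))"
        using b by (intro mult_left_mono) auto
      also have "\<dots> \<le> q \<bullet> (?v - y i)" using v pos le by (intro opt) auto
      finally show "b i * ln (1 + t * (- 1)) \<le> t * - (q \<bullet> y i)"
        by (simp add: algebra_simps)
    qed
    then show "q \<bullet> y i \<le> b i" by simp
    assume z: "z \<in> nonneg_orthant" "q \<bullet> z \<le> b i"
    \<comment> \<open>Now \<open>t *\<^sub>R z\<close> is added to \<open>y i\<close>, and the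
      relative utility gain is compared with the cost of \<open>z\<close>.\<close>
    have "b i * (u i z / u i (y i) - 1) \<le> q \<bullet> z"
    proof (rule ln_linear_growth_bound)
      fix t :: real assume t: "0 < t" "t < 1"
      let ?v = "y i + t *\<^sub>R z"
      have v: "?v \<in> nonneg_orthant" using yi z t by (intro nonneg_orthant_intros) auto
      note g = utility_add_scaled_pos[OF util yi(1) z(1) yi(2), of t]
      have "b i * ln (1 + t * (u i z / u i (y i) - 1)) \<le> b i * (ln (u i ?v) - ln (u i (y i)))"
        using b t g(3) by (intro mult_left_mono) auto
      also have "\<dots> \<le> q \<bullet> (?v - y i)" using v t g(1) by (intro opt) auto
      finally show "b i * ln (1 + t * (u i z / u i (y i) - 1)) \<le> t * (q \<bullet> z)" by simp
    qed
    also have "\<dots> \<le> b i * 1" using z by simp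
    \<comment> \<open>Affordability of \<open>z\<close> bounds the gain by 1, and the 1 already
      subtracted turns this into the factor 2.\<close>
    finally have "u i z / u i (y i) - 1 \<le> 1" using b by (simp only: mult_le_cancel_left_pos)
    then show "(1 / 2) * u i z \<le> u i (y i)" using yi by (simp add: field_simps)
  qed
  show ?thesis
    unfolding demand_approx_CE_def
    using agent y q saddle_prices_slackness(2)[OF q y]
    by (auto simp: positive_allocation_def saddle_prices_def)
qed

section \<open>Half envy-freeness by transfers\<close>

lemma nash_welfare_maximizing_half_envy_free:
  assumes market: "fisher_market A u b" and max: "nash_welfare_maximizing A u b y"
    and eq: "\<forall>i\<in>A. \<forall>k\<in>A. b i = b k"
  shows "half_envy_free A u y"
  unfolding half_envy_free_def
proof (intro ballI)
  fix i k assume i: "i \<in> A" and k: "k \<in> A"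
  note pos = nash_welfare_maximizing_positive[OF market max]
  have fin: "finite A" and bi: "0 < b i" using market i by (auto simp: fisher_market_def)
  have yi: "y i \<in> nonneg_orthant" "0 < u i (y i)" "utility_function (u i)"
    using pos market i by (auto simp: positive_allocation_def allocation_def fisher_market_def)
  have yk: "y k \<in> nonneg_orthant" "0 < u k (y k)" "utility_function (u k)"
    using pos market k by (auto simp: positive_allocation_def allocation_def fisher_market_def)
  show "(1 / 2) * u i (y k) \<le> u i (y i)"
  proof (cases "i = k")
    case True
    then show ?thesis using yi by simp
  next
    case False
    define r where "r = u i (y k) / u i (y i)"
    have transfer: "ln (1 + t * (r - 1)) + ln (1 - t) \<le> 0" if t: "0 < t" "t < 1" for t
    proof -
      let ?v = "y i + t *\<^sub>R y k" and ?w = "(1 - t) *\<^sub>R y k"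
      \<comment> \<open>Agent \<open>k\<close> hands the fraction \<open>t\<close> of its bundle to
        \<open>i\<close>, which preserves the total demand.\<close>
      let ?z = "(y(i := ?v))(k := ?w)"
      note g = utility_add_scaled_pos[OF yi(3,1) yk(1) yi(2), of t, folded r_def]
      have le: "(1 - t) * u k (y k) \<le> u k ?w" using t by (intro utility_scale yk) auto
      have pos_loss: "0 < (1 - t) * u k (y k)" using yk t by simp
      then have w: "0 < u k ?w" using le by linarith
      have "positive_allocation A u ?z"
        using t g(1) w yi yk
        by (intro positive_allocation_update pos nonneg_orthant_intros) auto
      moreover have "(\<Sum>a\<in>A. ?z a) = (\<Sum>a\<in>A. y a)"
        unfolding sum_update[OF fin k] sum_update[OF fin i] using False by (simp add: algebra_simps)
      then have "within_supply A ?z"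
        using max unfolding within_supply_iff nash_welfare_maximizing_def by simp
      ultimately have "eg_objective A u b ?z \<le> eg_objective A u b y"
        by (rule nash_welfare_maximizing_eg_objective[OF market max])
      \<comment> \<open>Equal budgets allow the common factor to be pulled out and
        cancelled.\<close>
      then have "b i * (ln (u i ?v) - ln (u i (y i)) + (ln (u k ?w) - ln (u k (y k)))) \<le> 0"
        unfolding eg_objective_update[OF fin k] eg_objective_update[OF fin i]
        using False eq[rule_format, OF k i] by (simp add: algebra_simps)
      then have "ln (u i ?v) - ln (u i (y i)) + (ln (u k ?w) - ln (u k (y k))) \<le> 0"
        using bi by (simp add: mult_le_0_iff)
      moreover have "ln (1 - t) + ln (u k (y k)) \<le> ln (u k ?w)"
        using ln_mono[OF le] w pos_loss yk t by (simp add: ln_mult)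
      ultimately show ?thesis using g(3) t by simp
    qed
    \<comment> \<open>The gain of \<open>i\<close> has rate \<open>r - 1\<close> and the loss of
      \<open>k\<close> rate 1, so optimality yields \<open>r \<le> 2\<close>.\<close>
    have "((\<lambda>t. ln (1 + t * (r - 1)) + ln (1 - t)) has_real_derivative (r - 1) + - 1) (at 0)"
      by (auto intro!: derivative_eq_intros)
    then have "r - 1 + - 1 \<le> 0"
      by (rule right_derivative_nonpos) (use transfer in auto)
    then show ?thesis using yi by (simp add: r_def field_simps)
  qed
qed

theorem theorem1p2:
  fixes A :: "'a set"
    and u :: "'a \<Rightarrow> real ^ 'm::finite \<Rightarrow> real"
    and b :: "'a \<Rightarrow> real"
    and y :: "'a \<Rightarrow> real ^ 'm"
  assumes "fisher_market A u b"
    and "nash_welfare_maximizing A u b y"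
  shows "(\<forall>q. gale_prices A u b q \<longrightarrow> demand_approx_CE 2 A u b y q) \<and>
         ((\<forall>i\<in>A. \<forall>k\<in>A. b i = b k) \<longrightarrow> half_envy_free A u y)"
proof (intro conjI allI impI)
  fix q assume q: "gale_prices A u b q"
  show "demand_approx_CE 2 A u b y q"
    using assms(2) saddle_prices_demand_approx_CE[OF assms(1) gale_prices_saddle[OF assms q]
      nash_welfare_maximizing_positive[OF assms]]
    by (simp add: nash_welfare_maximizing_def)
next
  assume "\<forall>i\<in>A. \<forall>k\<in>A. b i = b k"
  with assms show "half_envy_free A u y"
    by (rule nash_welfare_maximizing_half_envy_free)
qed

end
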